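(* Let $H(\mathbb{C})$ be the space of entire holomorphic functions with the topology of uniform convergence on compact sets, and let $H'(\mathbb{C})$ be its dual space, equipped with the strong topology. Then $H'(\mathbb{C})$ can be identified with the space $\mathcal{O}_0$ of germs of holomorphic functions at zero.
   Context: $\mathbb D$ is the open unit disk. For an integer $p$, $\mathbf H_2(2^{p}\mathbb D)$ denotes the Hardy space of the disk $2^p\mathbb D$; in terms of power series, $\mathbf H_2(2^{p}\mathbb D)=\{\sum_{n\ge0}a_nz^n:\sum_{n\ge0}|a_n|^2 2^{2np}<\infty\}$. The space $H(\mathbb C)=\bigcap_{p\in\mathbb N}\mathbf H_2(2^p\mathbb D)$ is a countably Hilbert space, and its strong dual is written as $H'(\mathbb C)=\bigcup_{p\in\mathbb N}\mathbf H_2(2^{-p}\mathbb D)$, where $\mathbf H_2(\mathbb D)\subseteq\mathbf H_2(2^{-1}\mathbb D)\subseteq\cdots\subseteq\mathbf H_2(2^{-p}\mathbb D)\subseteq\cdots$. The identification of $H'(\mathbb C)$ with $\mathcal O_0$ is stated as a conclusion from this description of $H'(\mathbb C)$ as a union of Hardy spaces on shrinking disks around $0$. *)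

theory Defs
  imports "HOL-Complex_Analysis.Complex_Analysis"
begin

definition seminorm :: "(complex \<Rightarrow> 'a::ab_group_add \<Rightarrow> 'a) \<Rightarrow> ('a \<Rightarrow> real) \<Rightarrow> bool" where
  "seminorm scl q \<longleftrightarrow>
     (\<forall>x y. q (x + y) \<le> q x + q y) \<and> (\<forall>c x. q (scl c x) = cmod c * q x)"

text \<open>The locally convex topology determined by a family of seminorms: its open sets are
  generated by the open semiballs.  It is used only for nonempty families of seminorms.\<close>

definition seminorm_topology :: "('a::ab_group_add \<Rightarrow> real) set \<Rightarrow> 'a topology" where
  "seminorm_topology P =
     topology_generated_by {{y. q (y - x) < e} | q x e. q \<in> P \<and> e > 0}"

text \<open>Boundedness in a topological vector space: being absorbed by every neighbourhood of 0.\<close>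

definition tvs_bounded ::
    "(complex \<Rightarrow> 'a::ab_group_add \<Rightarrow> 'a) \<Rightarrow> 'a topology \<Rightarrow> 'a set \<Rightarrow> bool" where
  "tvs_bounded scl T B \<longleftrightarrow>
     (\<forall>U. openin T U \<and> 0 \<in> U \<longrightarrow> (\<exists>s>0. \<forall>c. s \<le> cmod c \<longrightarrow> B \<subseteq> scl c ` U))"

typedef entire = "{f :: complex \<Rightarrow> complex. f holomorphic_on UNIV}"
  morphisms entire_apply Abs_entire
  by (rule exI[of _ "\<lambda>_. 0"]) simp

setup_lifting type_definition_entire

instantiation entire :: ab_group_add
begin
lift_definition zero_entire :: entire is "\<lambda>_. 0" by simp
lift_definition plus_entire :: "entire \<Rightarrow> entire \<Rightarrow> entire" is "\<lambda>f g z. f z + g z"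
  by (auto intro: holomorphic_intros)
lift_definition minus_entire :: "entire \<Rightarrow> entire \<Rightarrow> entire" is "\<lambda>f g z. f z - g z"
  by (auto intro: holomorphic_intros)
lift_definition uminus_entire :: "entire \<Rightarrow> entire" is "\<lambda>f z. - f z"
  by (auto intro: holomorphic_intros)
instance by standard (transfer; simp add: algebra_simps fun_eq_iff)+
end

lift_definition entire_scale :: "complex \<Rightarrow> entire \<Rightarrow> entire" is "\<lambda>c f z. c * f z"
  by (auto intro: holomorphic_intros)

lemma vector_space_entire: "vector_space entire_scale"
  by standard (transfer; simp add: algebra_simps fun_eq_iff)+

definition entire_coeff :: "entire \<Rightarrow> nat \<Rightarrow> complex" where
  "entire_coeff f n = (deriv ^^ n) (entire_apply f) 0 / fact n"

definition entire_topology :: "entire topology" where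
  "entire_topology =
     seminorm_topology {\<lambda>f. SUP z\<in>K. cmod (entire_apply f z) | K. compact K \<and> K \<noteq> {}}"

typedef entire_dual =
    "{\<phi> :: entire \<Rightarrow> complex.
        Vector_Spaces.linear entire_scale (*) \<phi> \<and> continuous_map entire_topology euclidean \<phi>}"
  morphisms dual_apply Abs_entire_dual
  by (rule exI[of _ "\<lambda>_. 0"])
     (simp add: Vector_Spaces.linear_iff vector_space_entire vector_space_over_itself.vector_space_axioms)

setup_lifting type_definition_entire_dual

instantiation entire_dual :: ab_group_add
begin
lift_definition zero_entire_dual :: entire_dual is "\<lambda>_. 0"
  by (simp add: Vector_Spaces.linear_iff vector_space_entire vector_space_over_itself.vector_space_axioms)
lift_definition plus_entire_dual :: "entire_dual \<Rightarrow> entire_dual \<Rightarrow> entire_dual" is "\<lambda>\<phi> \<psi> f. \<phi> f + \<psi> f"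
  by (auto simp: Vector_Spaces.linear_iff algebra_simps intro: continuous_map_add)
lift_definition minus_entire_dual :: "entire_dual \<Rightarrow> entire_dual \<Rightarrow> entire_dual" is "\<lambda>\<phi> \<psi> f. \<phi> f - \<psi> f"
  by (auto simp: Vector_Spaces.linear_iff algebra_simps intro: continuous_map_diff)
lift_definition uminus_entire_dual :: "entire_dual \<Rightarrow> entire_dual" is "\<lambda>\<phi> f. - \<phi> f"
  by (auto simp: Vector_Spaces.linear_iff algebra_simps)
instance by standard (transfer; simp add: algebra_simps fun_eq_iff)+
end

lemma continuous_map_cmult:
  fixes \<phi> :: "'a \<Rightarrow> complex"
  assumes "continuous_map X euclidean \<phi>"
  shows "continuous_map X euclidean (\<lambda>x. c * \<phi> x)"
  using assms by (simp add: continuous_map_atin tendsto_mult_left)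

lift_definition dual_scale :: "complex \<Rightarrow> entire_dual \<Rightarrow> entire_dual" is "\<lambda>c \<phi> f. c * \<phi> f"
  by (auto simp: Vector_Spaces.linear_iff algebra_simps intro: continuous_map_cmult)

lemma vector_space_dual: "vector_space dual_scale"
  by standard (transfer; simp add: algebra_simps fun_eq_iff)+

text \<open>Uniform convergence on bounded sets; the suprema are finite since a continuous linear
  functional is bounded on a bounded set.\<close>

definition strong_dual_topology :: "entire_dual topology" where
  "strong_dual_topology =
     seminorm_topology
       {\<lambda>\<phi>. SUP f\<in>B. cmod (dual_apply \<phi> f) | B.
          tvs_bounded entire_scale entire_topology B \<and> B \<noteq> {}}"

text \<open>A germ is represented by a total function that is holomorphic on some neighbourhood of 0
  (its values elsewhere are irrelevant); two such functions have the same germ iff they agree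
  on some neighbourhood of 0.\<close>

definition germ_eq :: "(complex \<Rightarrow> complex) \<Rightarrow> (complex \<Rightarrow> complex) \<Rightarrow> bool" where
  "germ_eq f g \<longleftrightarrow> f analytic_on {0} \<and> g analytic_on {0} \<and> (\<forall>\<^sub>F z in nhds 0. f z = g z)"

quotient_type germ0 = "complex \<Rightarrow> complex" / partial: germ_eq
  morphisms rep_germ0 germ_of
proof (rule part_equivpI)
  show "\<exists>f. germ_eq f f"
    by (rule exI[of _ "\<lambda>_. 0"]) (simp add: germ_eq_def)
  show "symp germ_eq"
    by (auto simp: symp_def germ_eq_def eq_commute)
  show "transp germ_eq"
    by (auto simp: transp_def germ_eq_def elim: eventually_elim2)
qed

instantiation germ0 :: ab_group_add
begin
lift_definition zero_germ0 :: germ0 is "\<lambda>_. 0"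
  by (simp add: germ_eq_def)
lift_definition plus_germ0 :: "germ0 \<Rightarrow> germ0 \<Rightarrow> germ0" is "\<lambda>f g z. f z + g z"
  by (auto simp: germ_eq_def intro: analytic_intros elim: eventually_elim2)
lift_definition minus_germ0 :: "germ0 \<Rightarrow> germ0 \<Rightarrow> germ0" is "\<lambda>f g z. f z - g z"
  by (auto simp: germ_eq_def intro: analytic_intros elim: eventually_elim2)
lift_definition uminus_germ0 :: "germ0 \<Rightarrow> germ0" is "\<lambda>f z. - f z"
  by (auto simp: germ_eq_def intro: analytic_intros elim: eventually_mono)
instance
  by standard (transfer; auto simp: germ_eq_def algebra_simps intro!: analytic_intros)+
end

lift_definition germ_scale :: "complex \<Rightarrow> germ0 \<Rightarrow> germ0" is "\<lambda>c f z. c * f z"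
  by (auto simp: germ_eq_def intro: analytic_intros elim: eventually_mono)

lemma vector_space_germ: "vector_space germ_scale"
  by standard (transfer; auto simp: germ_eq_def algebra_simps intro!: analytic_intros)+

lift_definition germ_coeff :: "germ0 \<Rightarrow> nat \<Rightarrow> complex" is "\<lambda>f n. (deriv ^^ n) f 0 / fact n"
  by (auto simp: germ_eq_def fun_eq_iff cong: higher_deriv_cong_ev)

text \<open>The Hardy space of the disk of radius \<open>2 powi p\<close>, through power series; \<open>f\<close> matters
  only on the disk.\<close>

definition hardy2 :: "int \<Rightarrow> (complex \<Rightarrow> complex) set" where
  "hardy2 p = {f. f holomorphic_on ball 0 (2 powi p) \<and>
     summable (\<lambda>n. (cmod ((deriv ^^ n) f 0 / fact n))\<^sup>2 * 2 powi (2 * int n * p))}"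

definition hardy2_norm :: "int \<Rightarrow> (complex \<Rightarrow> complex) \<Rightarrow> real" where
  "hardy2_norm p f =
     sqrt (\<Sum>n. (cmod ((deriv ^^ n) f 0 / fact n))\<^sup>2 * 2 powi (2 * int n * p))"

text \<open>The locally convex inductive limit topology of the Hardy spaces on the shrinking disks
  of radius \<open>2 powi (- p)\<close>, i.e. the finest locally convex topology making every map that sends
  a function in such a Hardy space to its germ continuous: it is given by all seminorms whose
  restriction to each of these Hardy spaces is continuous, hence dominated by the norm.\<close>

definition germ_topology :: "germ0 topology" where
  "germ_topology =
     seminorm_topology
       {q. seminorm germ_scale q \<and>
           (\<forall>p::nat. \<exists>C. \<forall>f\<in>hardy2 (- int p). q (germ_of f) \<le> C * hardy2_norm (- int p) f)}"

end

theory Submission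
  imports Defs
begin

text \<open>A germ \<open>g\<close> acts on an entire function \<open>f\<close> by \<open>\<Sum>n. g\<^sub>n * f\<^sub>n\<close>, which converges absolutely
  because the coefficients of \<open>g\<close> grow at most geometrically while those of \<open>f\<close> decay faster than
  any geometric sequence; conversely, the values of a continuous functional on the powers of \<open>z\<close>
  grow at most geometrically and hence define a germ.  Cauchy's estimates on a bounded set of
  entire functions show that a strong seminorm restricts to a continuous seminorm on each Hardy
  space.  For the inverse, the values \<open>a\<^sub>n\<close> of a continuous seminorm \<open>q\<close> at the germs of \<open>z\<^sup>n\<close> decay
  faster than any geometric sequence, so the entire functions with \<open>\<bar>f\<^sub>n\<bar> \<le> a\<^sub>n\<close> form a bounded set, and
  \<open>q g \<le> \<Sum>n. \<bar>g\<^sub>n\<bar> * a\<^sub>n\<close> is attained by the pairing of \<open>g\<close> with one of them.\<close>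

section \<open>Seminorms and seminorm topologies\<close>

lemma seminorm_add: "seminorm scl q \<Longrightarrow> q (x + y) \<le> q x + q y"
  and seminorm_scale: "seminorm scl q \<Longrightarrow> q (scl c x) = cmod c * q x"
  by (auto simp: seminorm_def)

lemma seminorm_0:
  assumes "vector_space scl" "seminorm scl q"
  shows "q 0 = 0"
proof -
  interpret vector_space scl by fact
  show ?thesis
    using seminorm_scale[OF assms(2), of 0 0] by simp
qed

lemma seminorm_minus:
  assumes "vector_space scl" "seminorm scl q"
  shows "q (- x) = q x"
proof -
  interpret vector_space scl by fact
  show ?thesis
    using seminorm_scale[OF assms(2), of "-1" x] by simp
qed

lemma seminorm_nonneg:
  assumes "vector_space scl" "seminorm scl q"
  shows "0 \<le> q x"
  using seminorm_add[OF assms(2), of x "- x"] seminorm_minus[OF assms, of x] seminorm_0[OF assms]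
  by simp

lemma seminorm_sum:
  assumes "vector_space scl" "seminorm scl q"
  shows "q (\<Sum>i\<in>I. f i) \<le> (\<Sum>i\<in>I. q (f i))"
proof (induction I rule: infinite_finite_induct)
  case (insert i I)
  then show ?case
    using seminorm_add[OF assms(2), of "f i" "sum f I"] by simp
qed (use seminorm_0[OF assms] in auto)

text \<open>Dividing by \<open>c\<close> upgrades the one-sided estimate for scaled arguments to an
  equality. The seminorms on entire functions and on their dual are both suprema of this form:
  evaluation at points of a compact set, and evaluation at members of a bounded set.\<close>

lemma seminorm_SUP:
  fixes ev :: "'i \<Rightarrow> 'a::ab_group_add \<Rightarrow> complex"
  assumes vs: "vector_space scl" and ne: "I \<noteq> {}"
    and bdd: "\<And>x. bdd_above ((\<lambda>i. cmod (ev i x)) ` I)"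
    and add: "\<And>i x y. ev i (x + y) = ev i x + ev i y"
    and scale: "\<And>i c x. ev i (scl c x) = c * ev i x"
  shows "seminorm scl (\<lambda>x. SUP i\<in>I. cmod (ev i x))"
proof -
  interpret vector_space scl by fact
  let ?q = "\<lambda>x. SUP i\<in>I. cmod (ev i x)"
  have upper: "cmod (ev i x) \<le> ?q x" if "i \<in> I" for i x
    using bdd that by (rule cSUP_upper2) simp
  have le: "?q (scl c x) \<le> cmod c * ?q x" for c x
    using ne by (rule cSUP_least) (auto simp: scale norm_mult intro!: mult_left_mono upper)
  have "?q (scl c x) = cmod c * ?q x" for c x
  proof (cases "c = 0")
    case True
    have "cmod (ev i (scl c x)) = 0" for i using True by (simp only: scale) simp
    then show ?thesis using ne True by simp
  next
    case False
    have "cmod c * ?q x = cmod c * ?q (scl (inverse c) (scl c x))"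
      using False by simp
    also have "\<dots> \<le> cmod c * (cmod (inverse c) * ?q (scl c x))"
      by (intro mult_left_mono le) auto
    also have "\<dots> = ?q (scl c x)"
      using False by (simp add: norm_inverse)
    finally show ?thesis using le[of c x] by linarith
  qed
  moreover have "?q (x + y) \<le> ?q x + ?q y" for x y
    using ne
  proof (rule cSUP_least)
    fix i assume "i \<in> I"
    then show "cmod (ev i (x + y)) \<le> ?q x + ?q y"
      using norm_triangle_ineq[of "ev i x" "ev i y"] upper[of i x] upper[of i y]
      unfolding add by linarith
  qed
  ultimately show ?thesis unfolding seminorm_def by blast
qed

section \<open>Neighbourhoods and continuity in seminorm topologies\<close>

lemma openin_semiball:
  "q \<in> P \<Longrightarrow> e > 0 \<Longrightarrow> openin (seminorm_topology P) {y. q (y - x) < e}"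
  unfolding seminorm_topology_def by (intro topology_generated_by_Basis) blast

lemma topspace_seminorm_topology:
  assumes "vector_space scl" "\<And>q. q \<in> P \<Longrightarrow> seminorm scl q" "P \<noteq> {}"
  shows "topspace (seminorm_topology P) = UNIV"
proof -
  obtain q where q: "q \<in> P" using assms(3) by blast
  have "x \<in> topspace (seminorm_topology P)" for x
    using openin_subset[OF openin_semiball[OF q, of 1 x]] seminorm_0[OF assms(1) assms(2)[OF q]]
    by auto
  then show ?thesis by blast
qed

text \<open>Induction over the generation of \<open>U\<close> from semiballs: intersections merge
  the finite families and take the smaller radius, and a semiball around another centre
  \<open>z\<close> contains one around \<open>x\<close> of radius \<open>e - q (x - z)\<close> by
  the triangle inequality.\<close>

lemma seminorm_topology_nhd:
  assumes sn: "\<And>q. q \<in> P \<Longrightarrow> seminorm scl q"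
    and "openin (seminorm_topology P) U" "x \<in> U"
  shows "\<exists>F e. finite F \<and> F \<subseteq> P \<and> e > 0 \<and> {y. \<forall>q\<in>F. q (y - x) < e} \<subseteq> U"
proof -
  have "generate_topology_on {{y. q (y - x) < e} | q x e. q \<in> P \<and> e > 0} U"
    using assms(2) unfolding seminorm_topology_def openin_topology_generated_by_iff .
  then show ?thesis using \<open>x \<in> U\<close>
  proof (induction rule: generate_topology_on.induct)
    case (Int A B)
    then obtain F d G e where
      F: "finite F" "F \<subseteq> P" "d > 0" "{y. \<forall>q\<in>F. q (y - x) < d} \<subseteq> A" and
      G: "finite G" "G \<subseteq> P" "e > 0" "{y. \<forall>q\<in>G. q (y - x) < e} \<subseteq> B"
      by auto
    then show ?case
      by (intro exI[of _ "F \<union> G"] exI[of _ "min d e"]) auto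
  next
    case (UN K)
    then obtain k where "k \<in> K" "x \<in> k" by blast
    with UN.IH[of k] show ?case by blast
  next
    case (Basis s)
    then obtain q z e where s: "s = {y. q (y - z) < e}" and q: "q \<in> P" and "e > 0" by blast
    have "q (y - z) < e" if "q (y - x) < e - q (x - z)" for y
      using seminorm_add[OF sn[OF q], of "y - x" "x - z"] that by simp
    then show ?case
      using q Basis.prems unfolding s
      by (intro exI[of _ "{q}"] exI[of _ "e - q (x - z)"]) auto
  qed simp
qed

text \<open>Around a point \<open>z\<close> of the preimage of a semiball, the
  \<open>p\<close>-semiball whose radius is the slack \<open>e - q (T z - x)\<close> stays inside
  the preimage.\<close>

lemma continuous_map_seminorm_topology:
  assumes P: "vector_space scl" "\<And>p. p \<in> P \<Longrightarrow> seminorm scl p" "P \<noteq> {}"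
    and Q: "vector_space scl'" "\<And>q. q \<in> Q \<Longrightarrow> seminorm scl' q" "Q \<noteq> {}"
    and diff: "\<And>x y. T (x - y) = T x - T y"
    and dom: "\<And>q. q \<in> Q \<Longrightarrow> \<exists>p\<in>P. \<forall>x. q (T x) \<le> p x"
  shows "continuous_map (seminorm_topology P) (seminorm_topology Q) T"
  unfolding seminorm_topology_def[of Q]
proof (rule continuous_on_generated_topo)
  fix U assume "U \<in> {{y. q (y - x) < e} | q x e. q \<in> Q \<and> e > 0}"
  then obtain q x e where U: "U = {y. q (y - x) < e}" and q: "q \<in> Q" and "e > 0" by blast
  obtain p where p: "p \<in> P" and le: "\<And>x. q (T x) \<le> p x" using dom[OF q] by blast
  have "openin (seminorm_topology P) (T -` U)"
  proof (subst openin_subopen, intro ballI)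
    fix z assume "z \<in> T -` U"
    then have pos: "e - q (T z - x) > 0" by (simp add: U)
    have "w \<in> T -` U" if "p (w - z) < e - q (T z - x)" for w
      using seminorm_add[OF Q(2)[OF q], of "T w - T z" "T z - x"] le[of "w - z"] that
      by (simp add: U diff)
    moreover have "p (z - z) < e - q (T z - x)"
      using seminorm_0[OF P(1) P(2)[OF p]] pos by simp
    ultimately show "\<exists>V. openin (seminorm_topology P) V \<and> z \<in> V \<and> V \<subseteq> T -` U"
      using openin_semiball[OF p pos, of z] by blast
  qed
  then show "openin (seminorm_topology P) (T -` U \<inter> topspace (seminorm_topology P))"
    by blast
next
  show "T ` topspace (seminorm_topology P) \<subseteq> \<Union> {{y. q (y - x) < e} | q x e. q \<in> Q \<and> e > 0}"
    using topspace_seminorm_topology[OF Q]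
    unfolding seminorm_topology_def topology_generated_by_topspace by blast
qed

lemma continuous_map_seminorm_topology_complex:
  fixes \<phi> :: "'a::ab_group_add \<Rightarrow> complex"
  assumes P: "vector_space scl" "\<And>p. p \<in> P \<Longrightarrow> seminorm scl p"
    and diff: "\<And>x y. \<phi> (x - y) = \<phi> x - \<phi> y"
    and p: "p \<in> P" "\<And>x. cmod (\<phi> x) \<le> C * p x" "C > 0"
  shows "continuous_map (seminorm_topology P) euclidean \<phi>"
  unfolding continuous_map_alt
proof (intro conjI allI impI)
  fix S :: "complex set" assume "openin euclidean S"
  then have S: "open S" by simp
  have "openin (seminorm_topology P) (\<phi> -` S)"
  proof (subst openin_subopen, intro ballI)
    fix z assume "z \<in> \<phi> -` S"
    then obtain e where e: "e > 0" "ball (\<phi> z) e \<subseteq> S"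
      using S open_contains_ball by (metis vimageE)
    have "w \<in> \<phi> -` S" if "p (w - z) < e / C" for w
    proof -
      have "cmod (\<phi> w - \<phi> z) < e"
        using p(2)[of "w - z"] that p(3) by (simp add: diff field_simps)
      then show ?thesis using e(2) by (auto simp: dist_norm norm_minus_commute)
    qed
    moreover have "p (z - z) < e / C"
      using seminorm_0[OF P(1) P(2)[OF p(1)]] e p(3) by simp
    ultimately show "\<exists>V. openin (seminorm_topology P) V \<and> z \<in> V \<and> V \<subseteq> \<phi> -` S"
      using openin_semiball[OF p(1), of "e / C" z] e p(3)
      by (intro exI[of _ "{w. p (w - z) < e / C}"]) auto
  qed
  then show "openin (seminorm_topology P) (\<phi> -` S \<inter> topspace (seminorm_topology P))"
    by blast
qed simp

section \<open>Entire functions\<close>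

lemma entire_apply_simps [simp]:
  "entire_apply (f + g) z = entire_apply f z + entire_apply g z"
  "entire_apply (f - g) z = entire_apply f z - entire_apply g z"
  "entire_apply (entire_scale c f) z = c * entire_apply f z"
  "entire_apply 0 z = 0"
  by (transfer; simp)+

lemma entire_apply_sum [simp]: "entire_apply (\<Sum>i\<in>I. f i) z = (\<Sum>i\<in>I. entire_apply (f i) z)"
  by (induction I rule: infinite_finite_induct) auto

lemma holomorphic_on_entire_apply: "entire_apply f holomorphic_on A"
  using entire_apply[of f] holomorphic_on_subset by blast

lemma compact_bdd_above_entire:
  assumes "compact K"
  shows "bdd_above ((\<lambda>z. cmod (entire_apply f z)) ` K)"
  using assms
  by (intro bounded_imp_bdd_above compact_imp_bounded compact_continuous_image
      continuous_on_norm holomorphic_on_imp_continuous_on holomorphic_on_entire_apply)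

lemma entire_bounded_on_cball:
  obtains M where "M > 0" "\<And>z. z \<in> cball 0 R \<Longrightarrow> cmod (entire_apply f z) \<le> M"
proof -
  have "bdd_above ((\<lambda>z. cmod (entire_apply f z)) ` cball 0 R)"
    by (rule compact_bdd_above_entire) simp
  then obtain M where M: "\<And>z. z \<in> cball 0 R \<Longrightarrow> cmod (entire_apply f z) \<le> M"
    unfolding bdd_above_def by blast
  show ?thesis
    by (rule that[of "max M 1"]) (use M in fastforce)+
qed

lemma seminorm_entire:
  assumes "q \<in> {\<lambda>f. SUP z\<in>K. cmod (entire_apply f z) | K. compact K \<and> K \<noteq> {}}"
  shows "seminorm entire_scale q"
  using assms by (auto intro!: seminorm_SUP vector_space_entire compact_bdd_above_entire)

section \<open>Taylor coefficients of entire functions\<close>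

lemma sums_entire: "(\<lambda>n. entire_coeff f n * z ^ n) sums entire_apply f z"
  using holomorphic_power_series[of "entire_apply f" 0 "cmod z + 1" z]
  by (simp add: entire_coeff_def holomorphic_on_entire_apply)

lemma entire_has_fps_expansion: "entire_apply f has_fps_expansion Abs_fps (entire_coeff f)"
proof -
  have "entire_apply f has_fps_expansion fps_expansion (entire_apply f) 0"
    by (rule has_fps_expansion_fps_expansion[of UNIV]) (auto simp: holomorphic_on_entire_apply)
  then show ?thesis
    by (simp add: fps_expansion_def entire_coeff_def[abs_def])
qed

lemma entire_coeff_eqI:
  "entire_apply f has_fps_expansion F \<Longrightarrow> entire_coeff f n = fps_nth F n"
  by (simp add: entire_coeff_def fps_nth_fps_expansion)

lemma entire_coeff_add: "entire_coeff (f + g) n = entire_coeff f n + entire_coeff g n"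
proof -
  have "entire_apply (f + g) has_fps_expansion Abs_fps (entire_coeff f) + Abs_fps (entire_coeff g)"
    unfolding plus_entire.rep_eq
    by (intro has_fps_expansion_add entire_has_fps_expansion)
  then show ?thesis by (simp add: entire_coeff_eqI)
qed

lemma entire_coeff_scale: "entire_coeff (entire_scale c f) n = c * entire_coeff f n"
proof -
  have "entire_apply (entire_scale c f) has_fps_expansion fps_const c * Abs_fps (entire_coeff f)"
    unfolding entire_scale.rep_eq
    by (intro has_fps_expansion_cmult_left entire_has_fps_expansion)
  then show ?thesis by (simp add: entire_coeff_eqI)
qed

lemma entire_coeff_bound:
  assumes "R > 0" "\<And>z. z \<in> cball 0 R \<Longrightarrow> cmod (entire_apply f z) \<le> M"
  shows "cmod (entire_coeff f n) \<le> M / R ^ n"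
proof -
  have "cmod ((deriv ^^ n) (entire_apply f) 0) \<le> fact n * M / R ^ n"
    using assms
    by (intro Cauchy_inequality holomorphic_on_imp_continuous_on holomorphic_on_entire_apply) auto
  then show ?thesis
    by (simp add: entire_coeff_def norm_divide field_simps)
qed

lift_definition entire_power :: "nat \<Rightarrow> entire" is "\<lambda>n z. z ^ n"
  by (auto intro: holomorphic_intros)

lemma entire_coeff_power: "entire_coeff (entire_power k) n = (if n = k then 1 else 0)"
  using entire_coeff_eqI[of "entire_power k" "fps_X ^ k" n]
  by (simp add: entire_power.rep_eq[abs_def] has_fps_expansion_fps_X_power)

lemma entire_of_coeffs:
  assumes "\<And>R. R > 0 \<Longrightarrow> summable (\<lambda>n. cmod (c n) * R ^ n)"
  obtains f where "\<And>n. entire_coeff f n = c n"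
proof -
  have "fps_conv_radius (Abs_fps c) = \<infinity>"
    unfolding fps_conv_radius_def
  proof (rule conv_radius_inftyI'')
    fix z :: complex
    \<comment> \<open>The added 1 keeps the radius positive when \<open>z\<close> is 0.\<close>
    have "summable (\<lambda>n. cmod (c n) * (cmod z + 1) ^ n)"
      by (rule assms) (simp add: add_nonneg_pos)
    then show "summable (\<lambda>n. fps_nth (Abs_fps c) n * z ^ n)"
      by (rule summable_comparison_test'[where N = 0])
        (auto simp: norm_mult norm_power intro!: mult_left_mono power_mono)
  qed
  then have fps: "eval_fps (Abs_fps c) has_fps_expansion Abs_fps c"
    and hol: "eval_fps (Abs_fps c) holomorphic_on UNIV"
    by (auto intro!: eval_fps_has_fps_expansion holomorphic_on_eval_fps)
  then have "entire_apply (Abs_entire (eval_fps (Abs_fps c))) = eval_fps (Abs_fps c)"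
    by (simp add: Abs_entire_inverse)
  with fps show ?thesis
    by (intro that[of "Abs_entire (eval_fps (Abs_fps c))"])
      (metis entire_coeff_eqI fps_nth_Abs_fps)
qed

section \<open>Neighbourhoods of zero and bounded sets of entire functions\<close>

lemma entire_topology_nhd:
  assumes "openin entire_topology U" "0 \<in> U"
  obtains R e where "R > 0" "e > 0"
    "\<And>f. (\<And>z. z \<in> cball 0 R \<Longrightarrow> cmod (entire_apply f z) \<le> e) \<Longrightarrow> f \<in> U"
proof -
  obtain F e where F: "finite F" "e > 0"
    "F \<subseteq> {\<lambda>f. SUP z\<in>K. cmod (entire_apply f z) | K. compact K \<and> K \<noteq> {}}"
    "{y. \<forall>q\<in>F. q (y - 0) < e} \<subseteq> U"
    using seminorm_topology_nhd[OF seminorm_entire assms[unfolded entire_topology_def]] by blast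
  have "\<forall>q\<in>F. \<exists>K. compact K \<and> K \<noteq> {} \<and> q = (\<lambda>f. SUP z\<in>K. cmod (entire_apply f z))"
    using F(3) by blast
  then obtain K where K: "\<And>q. q \<in> F \<Longrightarrow> compact (K q)" "\<And>q. q \<in> F \<Longrightarrow> K q \<noteq> {}"
    "\<And>q. q \<in> F \<Longrightarrow> q = (\<lambda>f. SUP z\<in>K q. cmod (entire_apply f z))"
    by metis
  \<comment> \<open>Finitely many compact sets lie in a single disc, so one bound on that disc
    controls every seminorm in \<open>F\<close>.\<close>
  have "bounded (\<Union>q\<in>F. K q)"
    using F(1) K(1) by (auto intro: compact_imp_bounded)
  then obtain R where R: "R > 0" "(\<Union>q\<in>F. K q) \<subseteq> cball 0 R"
    by (auto simp: bounded_pos subset_iff)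
  show ?thesis
  \<comment> \<open>Half of \<open>e\<close> is used because a bound on the values passes to the
    supremum only as a weak inequality, while semiballs are strict.\<close>
  proof (rule that[of R "e / 2"])
    fix f assume f: "\<And>z. z \<in> cball 0 R \<Longrightarrow> cmod (entire_apply f z) \<le> e / 2"
    have "q f < e" if "q \<in> F" for q
    proof -
      have "(SUP z\<in>K q. cmod (entire_apply f z)) \<le> e / 2"
        using K(2)[OF that] R(2) that f by (intro cSUP_least) auto
      then have "q f \<le> e / 2" by (subst K(3)[OF that])
      then show ?thesis using F(2) by simp
    qed
    with F(4) show "f \<in> U" by auto
  qed (use R F in auto)
qed

text \<open>The unit semiball of the supremum seminorm on the disc is the test neighbourhood; the
  factor by which it absorbs \<open>B\<close> serves as the bound.\<close>

lemma tvs_bounded_entireD: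
  assumes "tvs_bounded entire_scale entire_topology B" "R > 0"
  obtains M where "M > 0" "\<And>f z. f \<in> B \<Longrightarrow> z \<in> cball 0 R \<Longrightarrow> cmod (entire_apply f z) \<le> M"
proof -
  let ?q = "\<lambda>f. SUP z\<in>cball 0 R. cmod (entire_apply f z)"
  let ?P = "{\<lambda>f. SUP z\<in>K. cmod (entire_apply f z) | K. compact K \<and> K \<noteq> {}}"
  have q: "?q \<in> ?P" using assms(2) by (auto intro!: exI[of _ "cball 0 R"])
  let ?U = "{f. ?q (f - 0) < 1}"
  have "openin entire_topology ?U"
    unfolding entire_topology_def by (rule openin_semiball[OF q]) simp
  moreover have "0 \<in> ?U" using assms(2) by simp
  ultimately obtain s where s: "s > 0" "\<And>c. s \<le> cmod c \<Longrightarrow> B \<subseteq> entire_scale c ` ?U"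
    using assms(1) unfolding tvs_bounded_def by blast
  show ?thesis
  proof (rule that[of s])
    fix f and z :: complex assume "f \<in> B" and z: "z \<in> cball 0 R"
    then obtain u where u: "u \<in> ?U" "f = entire_scale (of_real s) u"
      using s(2)[of "of_real s"] s(1) by auto
    have "cmod (entire_apply u z) \<le> ?q u"
      using z by (intro cSUP_upper compact_bdd_above_entire) auto
    then have "cmod (entire_apply u z) \<le> 1" using u by simp
    then show "cmod (entire_apply f z) \<le> s" using u s(1) by (simp add: norm_mult)
  qed fact
qed

text \<open>A neighbourhood of 0 contains all functions that are small on one disc, and dividing by
  a large scalar makes all of \<open>B\<close> small there.\<close>

lemma tvs_bounded_entireI:
  assumes "\<And>R. R > 0 \<Longrightarrow> \<exists>M. \<forall>f\<in>B. \<forall>z\<in>cball 0 R. cmod (entire_apply f z) \<le> M"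
  shows "tvs_bounded entire_scale entire_topology B"
  unfolding tvs_bounded_def
proof (intro allI impI)
  fix U assume U: "openin entire_topology U \<and> 0 \<in> U"
  then obtain R e where R: "R > 0" "e > 0"
    and sub: "\<And>f. (\<And>z. z \<in> cball 0 R \<Longrightarrow> cmod (entire_apply f z) \<le> e) \<Longrightarrow> f \<in> U"
    using entire_topology_nhd by metis
  obtain M where M: "\<And>f z. f \<in> B \<Longrightarrow> z \<in> cball 0 R \<Longrightarrow> cmod (entire_apply f z) \<le> M"
    using assms[OF R(1)] by blast
  interpret vector_space entire_scale by (rule vector_space_entire)
  \<comment> \<open>Beyond \<open>M / e\<close> the rescaled values are at most \<open>e\<close>;
    the maximum with 1 keeps \<open>c\<close> nonzero and the threshold positive.\<close>
  have "B \<subseteq> entire_scale c ` U" if c: "max 1 (M / e) \<le> cmod c" for c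
  proof
    fix f assume f: "f \<in> B"
    have nz: "c \<noteq> 0" using c by auto
    have "entire_scale (inverse c) f \<in> U"
    proof (rule sub)
      fix z :: complex assume "z \<in> cball 0 R"
      then have "cmod (entire_apply f z) \<le> e * cmod c"
        using M[OF f, of z] c R(2) by (simp add: field_simps)
      then show "cmod (entire_apply (entire_scale (inverse c) f) z) \<le> e"
        using mult_left_mono[of _ _ "inverse (cmod c)"] nz
        by (fastforce simp: norm_mult norm_inverse norm_divide field_simps)
    qed
    moreover have "f = entire_scale c (entire_scale (inverse c) f)" using nz by simp
    ultimately show "f \<in> entire_scale c ` U" by blast
  qed
  then show "\<exists>s>0. \<forall>c. s \<le> cmod c \<longrightarrow> B \<subseteq> entire_scale c ` U"
    by (intro exI[of _ "max 1 (M / e)"]) auto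
qed

text \<open>The series of \<open>a n * R ^ n\<close> majorizes all power series of the set at once
  on the disc of radius \<open>R\<close>. A set of this form later dominates a given seminorm on
  germs.\<close>

lemma tvs_bounded_coeffs_le:
  assumes "\<And>R. R > 0 \<Longrightarrow> summable (\<lambda>n. a n * R ^ n)"
  shows "tvs_bounded entire_scale entire_topology {f. \<forall>n. cmod (entire_coeff f n) \<le> a n}"
proof (rule tvs_bounded_entireI)
  fix R :: real assume R: "R > 0"
  have "cmod (entire_apply f z) \<le> (\<Sum>n. a n * R ^ n)"
    if f: "\<forall>n. cmod (entire_coeff f n) \<le> a n" and z: "z \<in> cball 0 R" for f z
  proof -
    have "cmod (entire_coeff f n * z ^ n) \<le> a n * R ^ n" for n
      using f z order_trans[OF norm_ge_zero f[rule_format, of n]]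
      by (auto simp: norm_mult norm_power intro!: mult_mono power_mono)
    then have "cmod (\<Sum>n. entire_coeff f n * z ^ n) \<le> (\<Sum>n. a n * R ^ n)"
      by (intro norm_suminf_le assms R)
    then show ?thesis using sums_unique[OF sums_entire[of f z]] by simp
  qed
  then show "\<exists>M. \<forall>f\<in>{f. \<forall>n. cmod (entire_coeff f n) \<le> a n}.
      \<forall>z\<in>cball 0 R. cmod (entire_apply f z) \<le> M" by blast
qed

section \<open>The strong dual\<close>

lemma dual_apply_simps [simp]:
  "dual_apply \<phi> (f + g) = dual_apply \<phi> f + dual_apply \<phi> g"
  "dual_apply \<phi> (entire_scale c f) = c * dual_apply \<phi> f"
  "dual_apply (\<phi> + \<psi>) f = dual_apply \<phi> f + dual_apply \<psi> f"
  "dual_apply (\<phi> - \<psi>) f = dual_apply \<phi> f - dual_apply \<psi> f"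
  "dual_apply (dual_scale c \<phi>) f = c * dual_apply \<phi> f"
  using dual_apply[of \<phi>]
  by (simp_all add: Vector_Spaces.linear_iff plus_entire_dual.rep_eq minus_entire_dual.rep_eq
      dual_scale.rep_eq)

lemma dual_apply_diff [simp]: "dual_apply \<phi> (f - g) = dual_apply \<phi> f - dual_apply \<phi> g"
  using dual_apply_simps(1)[of \<phi> "f - g" g] by (simp del: dual_apply_simps)

lemma dual_apply_0 [simp]: "dual_apply \<phi> 0 = 0"
  using dual_apply_diff[of \<phi> 0 0] by simp

lemma dual_apply_sum [simp]: "dual_apply \<phi> (\<Sum>i\<in>I. f i) = (\<Sum>i\<in>I. dual_apply \<phi> (f i))"
  by (induction I rule: infinite_finite_induct) auto

lemma topspace_entire [simp]: "topspace entire_topology = UNIV"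
  unfolding entire_topology_def
  using topspace_seminorm_topology[OF vector_space_entire seminorm_entire]
  by (metis (mono_tags, lifting) compact_sing empty_iff insert_not_empty mem_Collect_eq)

text \<open>By continuity \<open>\<phi>\<close> is below 1 on functions bounded by some
  \<open>e\<close> on some disc; scaling by \<open>e / M\<close> then gives
  \<open>C = 1 / e\<close>. Any positive upper bound \<open>M\<close> is allowed instead of the
  supremum itself, so that the division is legitimate.\<close>

lemma dual_apply_bound:
  obtains R C where "R > 0" "C > 0"
    "\<And>f M. M > 0 \<Longrightarrow> (\<And>z. z \<in> cball 0 R \<Longrightarrow> cmod (entire_apply f z) \<le> M) \<Longrightarrow>
       cmod (dual_apply \<phi> f) \<le> C * M"
proof -
  let ?U = "{f \<in> topspace entire_topology. dual_apply \<phi> f \<in> ball 0 1}"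
  have "openin entire_topology ?U"
    using dual_apply[of \<phi>] by (intro openin_continuous_map_preimage) auto
  moreover have "0 \<in> ?U" by simp
  ultimately obtain R e where R: "R > 0" "e > 0"
    and sub: "\<And>f. (\<And>z. z \<in> cball 0 R \<Longrightarrow> cmod (entire_apply f z) \<le> e) \<Longrightarrow> f \<in> ?U"
    by (rule entire_topology_nhd) blast
  show ?thesis
  proof (rule that[of R "1 / e"])
    fix f M assume M: "M > 0" and f: "\<And>z. z \<in> cball 0 R \<Longrightarrow> cmod (entire_apply f z) \<le> M"
    have "entire_scale (of_real (e / M)) f \<in> ?U"
    proof (rule sub)
      fix z :: complex assume "z \<in> cball 0 R"
      then have "e / M * cmod (entire_apply f z) \<le> e / M * M"
        using M R(2) by (intro mult_left_mono f) auto
      then show "cmod (entire_apply (entire_scale (of_real (e / M)) f) z) \<le> e"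
        using M R(2) by (simp add: norm_mult norm_divide)
    qed
    then have "e / M * cmod (dual_apply \<phi> f) < 1"
      using M R(2) by (simp add: norm_mult norm_divide)
    then show "cmod (dual_apply \<phi> f) \<le> 1 / e * M"
      using M R(2) by (simp add: field_simps)
  qed (use R in auto)
qed

text \<open>Converse of \<open>dual_apply_bound\<close>: control by the supremum on one disc gives
  continuity. Here \<open>M\<close> need not be positive, since it is instantiated with the
  supremum, which may be 0.\<close>

lemma dual_apply_Abs_entire_dual:
  assumes "R > 0" "C > 0"
    and add: "\<And>f g. \<phi> (f + g) = \<phi> f + \<phi> g"
    and scale: "\<And>c f. \<phi> (entire_scale c f) = c * \<phi> f"
    and bound: "\<And>f M. (\<And>z. z \<in> cball 0 R \<Longrightarrow> cmod (entire_apply f z) \<le> M) \<Longrightarrow> cmod (\<phi> f) \<le> C * M"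
  shows "dual_apply (Abs_entire_dual \<phi>) = \<phi>"
proof (rule Abs_entire_dual_inverse, intro CollectI conjI)
  show "Vector_Spaces.linear entire_scale (*) \<phi>"
    by (simp add: Vector_Spaces.linear_iff vector_space_entire
        vector_space_over_itself.vector_space_axioms add scale)
  let ?q = "\<lambda>f. SUP z\<in>cball 0 R. cmod (entire_apply f z)"
  show "continuous_map entire_topology euclidean \<phi>"
    unfolding entire_topology_def
  proof (rule continuous_map_seminorm_topology_complex[OF vector_space_entire seminorm_entire,
        where p = ?q and C = C])
    show "\<phi> (f - g) = \<phi> f - \<phi> g" for f g
      using add[of "f - g" g] by simp
    show "cmod (\<phi> f) \<le> C * ?q f" for f
      by (intro bound cSUP_upper compact_bdd_above_entire) auto
    show "?q \<in> {\<lambda>f. SUP z\<in>K. cmod (entire_apply f z) | K. compact K \<and> K \<noteq> {}}"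
      using assms(1) by (auto intro!: exI[of _ "cball 0 R"])
  qed (use assms in auto)
qed

text \<open>A functional is controlled on one disc, where \<open>B\<close> is uniformly bounded.
  Hence the suprema defining the strong topology are genuine.\<close>

lemma bdd_above_dual_apply:
  assumes "tvs_bounded entire_scale entire_topology B"
  shows "bdd_above ((\<lambda>f. cmod (dual_apply \<phi> f)) ` B)"
proof -
  obtain R C where R: "R > 0" "C > 0"
    "\<And>f M. M > 0 \<Longrightarrow> (\<And>z. z \<in> cball 0 R \<Longrightarrow> cmod (entire_apply f z) \<le> M) \<Longrightarrow>
       cmod (dual_apply \<phi> f) \<le> C * M"
    by (rule dual_apply_bound) blast
  obtain M where "M > 0" "\<And>f z. f \<in> B \<Longrightarrow> z \<in> cball 0 R \<Longrightarrow> cmod (entire_apply f z) \<le> M"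
    using tvs_bounded_entireD[OF assms R(1)] by blast
  then show ?thesis
    by (intro bdd_aboveI2[where M = "C * M"] R(3)) auto
qed

lemma seminorm_strong_dual:
  assumes "q \<in> {\<lambda>\<phi>. SUP f\<in>B. cmod (dual_apply \<phi> f) | B.
          tvs_bounded entire_scale entire_topology B \<and> B \<noteq> {}}"
  shows "seminorm dual_scale q"
  using assms by (auto intro!: seminorm_SUP vector_space_dual bdd_above_dual_apply)

text \<open>The Taylor polynomials converge to \<open>f\<close> uniformly on the disc that controls
  \<open>\<phi>\<close>, so \<open>\<phi>\<close> may be applied term by term.\<close>

lemma dual_apply_sums:
  "(\<lambda>n. entire_coeff f n * dual_apply \<phi> (entire_power n)) sums dual_apply \<phi> f"
proof -
  obtain R C where R: "R > 0" "C > 0"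
    and bound: "\<And>f M. M > 0 \<Longrightarrow> (\<And>z. z \<in> cball 0 R \<Longrightarrow> cmod (entire_apply f z) \<le> M) \<Longrightarrow>
       cmod (dual_apply \<phi> f) \<le> C * M"
    by (rule dual_apply_bound) blast
  define P where "P N = (\<Sum>n<N. entire_scale (entire_coeff f n) (entire_power n))" for N
  have lim: "uniform_limit (cball 0 R) (\<lambda>N z. \<Sum>n<N. entire_coeff f n * z ^ n) (entire_apply f) sequentially"
  proof -
    have "uniform_limit (cball 0 R) (\<lambda>N z. \<Sum>n<N. entire_coeff f n * z ^ n)
        (\<lambda>z. \<Sum>n. entire_coeff f n * z ^ n) sequentially"
    proof (rule Weierstrass_m_test)
      show "summable (\<lambda>n. cmod (entire_coeff f n * of_real R ^ n))"
      proof (rule powser_insidea)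
        \<comment> \<open>Convergence at a point farther out than \<open>R\<close> gives absolute
          convergence at radius \<open>R\<close>.\<close>
        show "summable (\<lambda>n. entire_coeff f n * (of_real (R + 1)) ^ n)"
          using sums_entire by (rule sums_summable)
      qed (use R in auto)
      show "cmod (entire_coeff f n * z ^ n) \<le> cmod (entire_coeff f n * of_real R ^ n)"
        if "z \<in> cball 0 R" for n z
        using that R by (auto simp: norm_mult norm_power intro!: mult_left_mono power_mono)
    qed
    moreover have "(\<Sum>n. entire_coeff f n * z ^ n) = entire_apply f z" for z
      using sums_entire by (rule sums_unique[symmetric])
    ultimately show ?thesis by simp
  qed
  have "(\<lambda>N. dual_apply \<phi> (P N)) \<longlonglongrightarrow> dual_apply \<phi> f"
  proof (rule tendstoI)
    fix e :: real assume e: "e > 0"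
    have "\<forall>\<^sub>F N in sequentially. \<forall>z\<in>cball 0 R.
        dist (\<Sum>n<N. entire_coeff f n * z ^ n) (entire_apply f z) < e / (2 * C)"
      using uniform_limitD[OF lim] e R by simp
    then show "\<forall>\<^sub>F N in sequentially. dist (dual_apply \<phi> (P N)) (dual_apply \<phi> f) < e"
    proof eventually_elim
      case (elim N)
      \<comment> \<open>The uniform error \<open>e / (2 * C)\<close> becomes \<open>e / 2\<close>
        under \<open>\<phi>\<close>, strictly below \<open>e\<close>.\<close>
      have "cmod (dual_apply \<phi> (P N - f)) \<le> C * (e / (2 * C))"
      proof (rule bound)
        show "e / (2 * C) > 0" using e R by simp
        fix z :: complex assume "z \<in> cball 0 R"
        with elim have "dist (\<Sum>n<N. entire_coeff f n * z ^ n) (entire_apply f z) < e / (2 * C)"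
          by blast
        then show "cmod (entire_apply (P N - f) z) \<le> e / (2 * C)"
          by (simp add: P_def entire_power.rep_eq dist_norm)
      qed
      also have "\<dots> < e" using e R by simp
      finally show ?case by (simp add: dist_norm)
    qed
  qed
  then show ?thesis by (simp add: sums_def P_def)
qed

section \<open>Germs at the origin\<close>

lemma germ_eq_refl: "germ_eq f f \<longleftrightarrow> f analytic_on {0}"
  by (simp add: germ_eq_def)

lemma germ_cases:
  obtains f where "f analytic_on {0}" "g = germ_of f"
proof -
  have "\<exists>f. f analytic_on {0} \<and> g = germ_of f"
    by (induction g rule: germ0.abs_induct) (auto simp: germ_eq_refl)
  then show ?thesis using that by blast
qed

lemma germ_coeff_germ_of:
  "f analytic_on {0} \<Longrightarrow> germ_coeff (germ_of f) n = (deriv ^^ n) f 0 / fact n"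
  by (simp add: germ_coeff.abs_eq germ_eq_refl)

lemma analytic_germ_coeff_fps:
  assumes "f analytic_on {0}"
  shows "f has_fps_expansion Abs_fps (germ_coeff (germ_of f))"
proof -
  have "fps_expansion f 0 = Abs_fps (germ_coeff (germ_of f))"
    by (simp add: fps_expansion_def fps_eq_iff germ_coeff_germ_of assms)
  then show ?thesis
    using analytic_at_imp_has_fps_expansion_0[OF assms] by simp
qed

lemma germ_coeff_eqI:
  "f has_fps_expansion F \<Longrightarrow> germ_coeff (germ_of f) n = fps_nth F n"
  by (simp add: germ_coeff_germ_of has_fps_expansion_imp_analytic_0 fps_nth_fps_expansion)

text \<open>Both representatives coincide near 0 with the sum of the same power series, hence with
  each other.\<close>

lemma germ_eqI:
  assumes "\<And>n. germ_coeff g n = germ_coeff h n"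
  shows "g = h"
proof -
  obtain f where f: "f analytic_on {0}" "g = germ_of f" by (rule germ_cases)
  obtain k where k: "k analytic_on {0}" "h = germ_of k" by (rule germ_cases)
  have "germ_coeff g = germ_coeff h" using assms by blast
  then have "f has_fps_expansion Abs_fps (germ_coeff h)"
    "k has_fps_expansion Abs_fps (germ_coeff h)"
    using analytic_germ_coeff_fps f k by metis+
  then have "\<forall>\<^sub>F z in nhds 0. f z = k z"
    unfolding has_fps_expansion_def by (auto elim: eventually_elim2)
  with f k have "germ_eq f k" by (simp add: germ_eq_def)
  with f k show ?thesis using Quotient_rel_abs[OF Quotient_germ0] by blast
qed

lemma germ_coeff_add: "germ_coeff (g + h) n = germ_coeff g n + germ_coeff h n"
proof -
  obtain f where f: "f analytic_on {0}" "g = germ_of f" by (rule germ_cases)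
  obtain k where k: "k analytic_on {0}" "h = germ_of k" by (rule germ_cases)
  have "g + h = germ_of (\<lambda>z. f z + k z)"
    using f k by (simp add: plus_germ0.abs_eq germ_eq_refl)
  moreover have "(\<lambda>z. f z + k z) has_fps_expansion
      Abs_fps (germ_coeff g) + Abs_fps (germ_coeff h)"
    using f k by (auto intro: has_fps_expansion_add analytic_germ_coeff_fps)
  ultimately show ?thesis by (simp add: germ_coeff_eqI)
qed

lemma germ_coeff_scale: "germ_coeff (germ_scale c g) n = c * germ_coeff g n"
proof -
  obtain f where f: "f analytic_on {0}" "g = germ_of f" by (rule germ_cases)
  have "germ_scale c g = germ_of (\<lambda>z. c * f z)"
    using f by (simp add: germ_scale.abs_eq germ_eq_refl)
  moreover have "(\<lambda>z. c * f z) has_fps_expansion fps_const c * Abs_fps (germ_coeff g)"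
    using f by (auto intro: has_fps_expansion_cmult_left analytic_germ_coeff_fps)
  ultimately show ?thesis by (simp add: germ_coeff_eqI)
qed

lemma germ_coeff_diff: "germ_coeff (g - h) n = germ_coeff g n - germ_coeff h n"
  using germ_coeff_add[of "g - h" h n] by simp

lemma germ_coeff_sum: "germ_coeff (\<Sum>i\<in>I. g i) n = (\<Sum>i\<in>I. germ_coeff (g i) n)"
proof -
  have "germ_coeff 0 n = 0" using germ_coeff_diff[of 0 0 n] by simp
  then show ?thesis
    by (induction I rule: infinite_finite_induct) (auto simp: germ_coeff_add)
qed

abbreviation germ_power :: "nat \<Rightarrow> germ0" where
  "germ_power k \<equiv> germ_of (\<lambda>z. z ^ k)"

lemma germ_coeff_power: "germ_coeff (germ_power k) n = (if n = k then 1 else 0)"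
  using germ_coeff_eqI[OF has_fps_expansion_fps_X_power, of k n] by simp

text \<open>Inside the disc of convergence the terms of the series are bounded; this is the
  geometric growth of the coefficients, with \<open>germ_of_coeffs\<close> as its converse.\<close>

lemma germ_coeff_bound:
  obtains r M where "r > 0" "M > 0" "\<And>n. cmod (germ_coeff g n) * r ^ n \<le> M"
proof -
  obtain f where f: "f analytic_on {0}" "g = germ_of f" by (rule germ_cases)
  have "fps_conv_radius (Abs_fps (germ_coeff g)) > 0"
    using analytic_germ_coeff_fps[OF f(1)] f(2) by (simp add: has_fps_expansion_def)
  then obtain r where r: "0 < r" "ereal r < fps_conv_radius (Abs_fps (germ_coeff g))"
    using ereal_dense2[of 0] by (metis ereal_less(2) zero_ereal_def less_ereal.simps(1))
  have "summable (\<lambda>n. cmod (germ_coeff g n * of_real r ^ n))"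
    using norm_summable_fps[of "of_real r" "Abs_fps (germ_coeff g)"] r by simp
  then have "Bseq (\<lambda>n. cmod (germ_coeff g n * of_real r ^ n))"
    by (intro convergent_imp_Bseq summable_imp_convergent)
  then obtain M where "M > 0" "\<And>n. cmod (germ_coeff g n) * r ^ n \<le> M"
    using r(1) by (auto simp: Bseq_def norm_mult norm_power)
  with r show ?thesis by (intro that)
qed

lemma germ_of_coeffs:
  assumes "R > 0" "\<And>n. cmod (c n) \<le> C * R ^ n"
  obtains g where "\<And>n. germ_coeff g n = c n"
proof -
  \<comment> \<open>At \<open>1 / (2 * R)\<close>, half the critical radius, the growth bound leaves
    a geometric majorant of ratio \<open>1 / 2\<close>.\<close>
  have "summable (\<lambda>n. c n * of_real (1 / (2 * R)) ^ n)"
  proof (rule summable_comparison_test')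
    show "summable (\<lambda>n. C * (1 / 2) ^ n :: real)"
      by (intro summable_mult summable_geometric) simp
    show "cmod (c n * of_real (1 / (2 * R)) ^ n) \<le> C * (1 / 2) ^ n" if "n \<ge> 0" for n
    proof -
      have "cmod (c n * of_real (1 / (2 * R)) ^ n) \<le> C * R ^ n * (1 / (2 * R)) ^ n"
        using assms(1) by (auto simp: norm_mult norm_power norm_divide intro!: mult_right_mono assms(2))
      also have "\<dots> = C * (1 / 2) ^ n"
        using assms(1) by (simp add: field_simps)
      finally show ?thesis .
    qed
  qed
  then have "conv_radius c \<ge> norm (of_real (1 / (2 * R)) :: complex)"
    by (rule conv_radius_geI)
  then have "fps_conv_radius (Abs_fps c) > 0"
    using assms(1) unfolding fps_conv_radius_def
    by (simp add: norm_divide) (metis ereal_less(2) less_le_trans zero_less_divide_1_iff zero_less_mult_iff zero_less_numeral)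
  then have "eval_fps (Abs_fps c) has_fps_expansion Abs_fps c"
    by (rule eval_fps_has_fps_expansion)
  then show ?thesis
    by (intro that[of "germ_of (eval_fps (Abs_fps c))"]) (simp add: germ_coeff_eqI)
qed

section \<open>Hardy spaces\<close>

text \<open>Writing the weight as a square makes the Hardy norm the l2 norm of the coefficients
  times \<open>r ^ n\<close> with \<open>r = 1 / 2 ^ p\<close>.\<close>

lemma powi_hardy2_weight: "(2::real) powi (2 * int n * - int p) = ((1 / 2 ^ p) ^ n)\<^sup>2"
proof -
  have "2 * int n * - int p = - int (p * n * 2)" by simp
  then show ?thesis
    by (simp only: power_int_minus power_int_of_nat power_mult)
      (simp add: power_one_over inverse_eq_divide)
qed

lemma hardy2_analytic: "f \<in> hardy2 p \<Longrightarrow> f analytic_on {0}"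
  unfolding hardy2_def analytic_at by (auto intro!: exI[of _ "ball 0 (2 powi p)"])

lemma mem_hardy2_iff:
  assumes "f analytic_on {0}"
  shows "f \<in> hardy2 (- int p) \<longleftrightarrow> f holomorphic_on ball 0 (1 / 2 ^ p) \<and>
     summable (\<lambda>n. (cmod (germ_coeff (germ_of f) n) * (1 / 2 ^ p) ^ n)\<^sup>2)"
  unfolding hardy2_def mem_Collect_eq powi_hardy2_weight germ_coeff_germ_of[OF assms]
  by (simp add: power_mult_distrib power_int_minus inverse_eq_divide)

lemma hardy2_norm_eq:
  assumes "f analytic_on {0}"
  shows "hardy2_norm (- int p) f =
    sqrt (\<Sum>n. (cmod (germ_coeff (germ_of f) n) * (1 / 2 ^ p) ^ n)\<^sup>2)"
  unfolding hardy2_norm_def powi_hardy2_weight germ_coeff_germ_of[OF assms]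
  by (simp add: power_mult_distrib)

text \<open>One term of a series of squares is at most the whole sum. This supplies the growth
  hypothesis of \<open>coeff_pairing\<close> with the Hardy norm as constant.\<close>

lemma germ_coeff_le_hardy2_norm:
  assumes "f \<in> hardy2 (- int p)"
  shows "cmod (germ_coeff (germ_of f) n) * (1 / 2 ^ p) ^ n \<le> hardy2_norm (- int p) f"
proof -
  let ?t = "\<lambda>n. (cmod (germ_coeff (germ_of f) n) * (1 / 2 ^ p) ^ n)\<^sup>2"
  have an: "f analytic_on {0}" using assms by (rule hardy2_analytic)
  have "sum ?t {n} \<le> suminf ?t"
    using assms an by (intro sum_le_suminf) (auto simp: mem_hardy2_iff)
  then show ?thesis
    unfolding hardy2_norm_eq[OF an] by (intro real_le_rsqrt) simp
qed

text \<open>This is the exhaustion of the germs by the Hardy spaces on shrinking discs.\<close>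

lemma analytic_imp_hardy2:
  assumes "f analytic_on {0}"
  obtains p where "f \<in> hardy2 (- int p)"
proof -
  obtain d where d: "d > 0" "f holomorphic_on ball 0 d"
    using assms by (auto simp: analytic_on_def)
  obtain r M where r: "r > 0" "M > 0" "\<And>n. cmod (germ_coeff (germ_of f) n) * r ^ n \<le> M"
    by (rule germ_coeff_bound) blast
  \<comment> \<open>Radius below \<open>d\<close> gives holomorphy on the disc; radius below
    \<open>r / 2\<close> leaves a factor \<open>(1 / 2) ^ n\<close>, hence squares of ratio
    \<open>1 / 4\<close>.\<close>
  obtain p where p: "(1 / 2) ^ p < min d (r / 2)"
    using real_arch_pow_inv[of "min d (r / 2)" "1 / 2"] d(1) r(1) by auto
  have "f holomorphic_on ball 0 (1 / 2 ^ p)"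
    using d(2) by (rule holomorphic_on_subset) (use p in \<open>auto simp: power_one_over\<close>)
  moreover have "summable (\<lambda>n. (cmod (germ_coeff (germ_of f) n) * (1 / 2 ^ p) ^ n)\<^sup>2)"
  proof (rule summable_comparison_test')
    show "summable (\<lambda>n. M\<^sup>2 * (1 / 4) ^ n)"
      by (intro summable_mult summable_geometric) simp
    fix n
    have "cmod (germ_coeff (germ_of f) n) * (1 / 2 ^ p) ^ n
        \<le> cmod (germ_coeff (germ_of f) n) * (r / 2) ^ n"
      using p by (intro mult_left_mono power_mono) (auto simp: power_one_over)
    also have "\<dots> \<le> M * (1 / 2) ^ n"
      using mult_right_mono[OF r(3)[of n], of "(1 / 2) ^ n"] by (simp add: power_divide)
    finally have "(cmod (germ_coeff (germ_of f) n) * (1 / 2 ^ p) ^ n)\<^sup>2 \<le> (M * (1 / 2) ^ n)\<^sup>2"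
      by (intro power_mono) auto
    also have "\<dots> = M\<^sup>2 * (1 / 4) ^ n"
      by (simp add: power_mult_distrib power2_eq_square flip: power_mult_distrib)
    finally show "norm ((cmod (germ_coeff (germ_of f) n) * (1 / 2 ^ p) ^ n)\<^sup>2) \<le> M\<^sup>2 * (1 / 4) ^ n"
      by simp
  qed
  ultimately have "f \<in> hardy2 (- int p)" by (simp add: mem_hardy2_iff[OF assms])
  then show ?thesis by (rule that)
qed

text \<open>These norms, taken for every \<open>p\<close>, force any continuous seminorm to decay
  faster than geometrically along the monomials.\<close>

lemma hardy2_power:
  "(\<lambda>z. z ^ k) \<in> hardy2 (- int p)" (is ?mem)
  "hardy2_norm (- int p) (\<lambda>z. z ^ k) = (1 / 2 ^ p) ^ k" (is ?norm)
proof -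
  have an: "(\<lambda>z::complex. z ^ k) analytic_on {0}" by (intro analytic_intros)
  have "(\<lambda>n. (cmod (germ_coeff (germ_power k) n) * (1 / 2 ^ p) ^ n)\<^sup>2) =
      (\<lambda>n. if n = k then ((1 / 2 ^ p) ^ k)\<^sup>2 else 0)"
    by (auto simp: germ_coeff_power fun_eq_iff)
  then have sums: "(\<lambda>n. (cmod (germ_coeff (germ_power k) n) * (1 / 2 ^ p) ^ n)\<^sup>2) sums ((1 / 2 ^ p) ^ k)\<^sup>2"
    using sums_single[of k "\<lambda>_. ((1 / 2 ^ p) ^ k)\<^sup>2 :: real"] by simp
  show ?mem
    using sums_summable[OF sums] by (auto simp: mem_hardy2_iff[OF an] intro!: holomorphic_intros)
  show ?norm
    unfolding hardy2_norm_eq[OF an] sums_unique[OF sums, symmetric] by simp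
qed

lemma germ_of_partial_sum:
  "germ_of (\<lambda>z. \<Sum>n\<in>I. c n * z ^ n) = (\<Sum>n\<in>I. germ_scale (c n) (germ_power n))"
proof (induction I rule: infinite_finite_induct)
  case (insert i I)
  \<comment> \<open>The quotient is partial, so the operations on germs can be computed only on
    representatives known to be analytic at 0.\<close>
  have "germ_eq (\<lambda>z. c i * z ^ i) (\<lambda>z. c i * z ^ i)" "germ_eq (\<lambda>z. z ^ i) (\<lambda>z. z ^ i)"
    "germ_eq (\<lambda>z. \<Sum>n\<in>I. c n * z ^ n) (\<lambda>z. \<Sum>n\<in>I. c n * z ^ n)"
    by (auto simp: germ_eq_refl intro!: analytic_intros)
  then show ?case
    using insert by (simp add: plus_germ0.abs_eq germ_scale.abs_eq flip: insert.IH)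
qed (simp_all add: zero_germ0_def)

text \<open>Subtracting a Taylor polynomial deletes the first \<open>N\<close> coefficients, so the
  squared norm of the remainder is the tail of a convergent series. Polynomials are therefore dense
  in each Hardy space.\<close>

lemma hardy2_remainder:
  assumes "f \<in> hardy2 (- int p)"
  defines "F \<equiv> \<lambda>N z. f z - (\<Sum>n<N. germ_coeff (germ_of f) n * z ^ n)"
  shows "F N \<in> hardy2 (- int p)" (is ?mem)
    and "germ_of (F N) = germ_of f - (\<Sum>n<N. germ_scale (germ_coeff (germ_of f) n) (germ_power n))"
      (is ?germ)
    and "(\<lambda>N. hardy2_norm (- int p) (F N)) \<longlonglongrightarrow> 0" (is ?lim)
proof -
  let ?c = "germ_coeff (germ_of f)"
  let ?t = "\<lambda>n. (cmod (?c n) * (1 / 2 ^ p) ^ n)\<^sup>2"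
  have an: "f analytic_on {0}" using assms(1) by (rule hardy2_analytic)
  have poly: "(\<lambda>z. \<Sum>n<N. ?c n * z ^ n) analytic_on {0}" for N
    by (intro analytic_intros)
  have anF: "F N analytic_on {0}" for N
    unfolding F_def by (intro analytic_intros an)
  have germ: "germ_of (F N) = germ_of f - (\<Sum>n<N. germ_scale (?c n) (germ_power n))" for N
    unfolding F_def germ_of_partial_sum[symmetric]
    using an poly by (simp add: minus_germ0.abs_eq germ_eq_refl)
  show ?germ by (rule germ)
  have coeff: "germ_coeff (germ_of (F N)) n = (if n < N then 0 else ?c n)" for N n
    by (simp add: germ germ_coeff_diff germ_coeff_sum germ_coeff_scale germ_coeff_power
        if_distrib cong: if_cong)
  have t: "summable ?t" using assms(1) by (simp add: mem_hardy2_iff[OF an])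
  have sums: "(\<lambda>n. (cmod (germ_coeff (germ_of (F N)) n) * (1 / 2 ^ p) ^ n)\<^sup>2)
      sums (suminf ?t - sum ?t {..<N})" for N
  proof -
    have "(\<lambda>n. ?t n - (if n \<in> {..<N} then ?t n else 0)) sums (suminf ?t - sum ?t {..<N})"
      by (intro sums_diff summable_sums t sums_If_finite_set) simp
    moreover have "(\<lambda>n. ?t n - (if n \<in> {..<N} then ?t n else 0)) =
        (\<lambda>n. (cmod (germ_coeff (germ_of (F N)) n) * (1 / 2 ^ p) ^ n)\<^sup>2)"
      by (auto simp: coeff fun_eq_iff)
    ultimately show ?thesis by simp
  qed
  show ?mem
    using assms(1) sums_summable[OF sums]
    by (auto simp: mem_hardy2_iff an anF) (auto simp: F_def intro!: holomorphic_intros)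
  have "(\<lambda>N. sqrt (suminf ?t - sum ?t {..<N})) \<longlonglongrightarrow> sqrt (suminf ?t - suminf ?t)"
    by (intro tendsto_intros summable_LIMSEQ t)
  then show ?lim
    unfolding hardy2_norm_eq[OF anF] sums_unique[OF sums, symmetric] by simp
qed

section \<open>The pairing of germs with entire functions\<close>

text \<open>Cauchy's estimate on radius \<open>2 / r\<close> bounds the coefficients of
  \<open>f\<close> by \<open>N * (r / 2) ^ n\<close>. The growth of \<open>a\<close> cancels
  \<open>r ^ n\<close>, and the remaining \<open>M * N * (1 / 2) ^ n\<close> sums to
  \<open>2 * M * N\<close>.\<close>

lemma coeff_pairing:
  assumes r: "r > 0" and a: "\<And>n. cmod (a n) * r ^ n \<le> M"
    and f: "\<And>z. z \<in> cball 0 (2 / r) \<Longrightarrow> cmod (entire_apply f z) \<le> N"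
  shows "summable (\<lambda>n. cmod (a n * entire_coeff f n))"
    and "cmod (\<Sum>n. a n * entire_coeff f n) \<le> 2 * M * N"
proof -
  have le: "cmod (a n * entire_coeff f n) \<le> M * N * (1 / 2) ^ n" for n
  proof -
    have "cmod (a n * entire_coeff f n) \<le> (M / r ^ n) * (N / (2 / r) ^ n)"
      unfolding norm_mult
    proof (rule mult_mono)
      show le: "cmod (a n) \<le> M / r ^ n"
        using a[of n] r by (simp add: field_simps)
      show "0 \<le> M / r ^ n"
        using norm_ge_zero le by (rule order_trans)
      show "cmod (entire_coeff f n) \<le> N / (2 / r) ^ n"
        using r f by (intro entire_coeff_bound) auto
    qed simp
    also have "\<dots> = M * N * (1 / 2) ^ n"
      using r by (simp add: power_divide field_simps)
    finally show ?thesis .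
  qed
  have geo: "(\<lambda>n. M * N * (1 / 2) ^ n) sums (M * N * 2)"
    using sums_mult[OF geometric_sums[of "1 / 2 :: real"], of "M * N"] by simp
  show sm: "summable (\<lambda>n. cmod (a n * entire_coeff f n))"
    using sums_summable[OF geo] by (rule summable_comparison_test'[where N = 0]) (use le in simp)
  have "cmod (\<Sum>n. a n * entire_coeff f n) \<le> (\<Sum>n. M * N * (1 / 2) ^ n)"
    by (intro norm_suminf_le le sums_summable[OF geo])
  then show "cmod (\<Sum>n. a n * entire_coeff f n) \<le> 2 * M * N"
    using sums_unique[OF geo] by simp
qed

lemma summable_germ_pairing: "summable (\<lambda>n. cmod (germ_coeff g n * entire_coeff f n))"
proof -
  obtain r M where r: "r > 0" "M > 0" "\<And>n. cmod (germ_coeff g n) * r ^ n \<le> M"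
    by (rule germ_coeff_bound) blast
  obtain N where "\<And>z. z \<in> cball 0 (2 / r) \<Longrightarrow> cmod (entire_apply f z) \<le> N"
    using entire_bounded_on_cball by metis
  with r show ?thesis by (intro coeff_pairing)
qed

text \<open>This is the residue pairing: the integral of \<open>f(z) g(1/z) / z\<close> over a large
  circle, divided by \<open>2 \<pi> i\<close>. No conjugation occurs, so it is complex linear in the
  germ.\<close>

definition germ_functional :: "germ0 \<Rightarrow> entire_dual" where
  "germ_functional g = Abs_entire_dual (\<lambda>f. \<Sum>n. germ_coeff g n * entire_coeff f n)"

lemma dual_apply_germ_functional:
  "dual_apply (germ_functional g) f = (\<Sum>n. germ_coeff g n * entire_coeff f n)"
proof -
  obtain r M where r: "r > 0" "M > 0" "\<And>n. cmod (germ_coeff g n) * r ^ n \<le> M"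
    by (rule germ_coeff_bound) blast
  note sm = summable_norm_cancel[OF summable_germ_pairing]
  have "dual_apply (germ_functional g) = (\<lambda>f. \<Sum>n. germ_coeff g n * entire_coeff f n)"
    unfolding germ_functional_def
  proof (rule dual_apply_Abs_entire_dual[of "2 / r" "2 * M"])
    show "(\<Sum>n. germ_coeff g n * entire_coeff (f + h) n) =
        (\<Sum>n. germ_coeff g n * entire_coeff f n) + (\<Sum>n. germ_coeff g n * entire_coeff h n)" for f h
      by (simp add: suminf_add sm entire_coeff_add distrib_left)
    show "(\<Sum>n. germ_coeff g n * entire_coeff (entire_scale c f) n) =
        c * (\<Sum>n. germ_coeff g n * entire_coeff f n)" for c f
      unfolding suminf_mult[OF sm, symmetric] by (simp add: entire_coeff_scale mult_ac)
    show "cmod (\<Sum>n. germ_coeff g n * entire_coeff f n) \<le> 2 * M * N"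
      if "\<And>z. z \<in> cball 0 (2 / r) \<Longrightarrow> cmod (entire_apply f z) \<le> N" for f N
      using r(1,3) that by (rule coeff_pairing)
  qed (use r in auto)
  then show ?thesis by simp
qed

lemma sums_germ_functional:
  "(\<lambda>n. germ_coeff g n * entire_coeff f n) sums dual_apply (germ_functional g) f"
  unfolding dual_apply_germ_functional
  by (intro summable_sums summable_norm_cancel[OF summable_germ_pairing])

lemma entire_dual_eqI: "(\<And>f. dual_apply \<phi> f = dual_apply \<psi> f) \<Longrightarrow> \<phi> = \<psi>"
  by (metis dual_apply_inject ext)

lemma germ_functional_add: "germ_functional (g + h) = germ_functional g + germ_functional h"
proof (rule entire_dual_eqI)
  fix f
  show "dual_apply (germ_functional (g + h)) f = dual_apply (germ_functional g + germ_functional h) f"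
    using sums_germ_functional[of "g + h" f]
  proof (rule sums_unique2)
    show "(\<lambda>n. germ_coeff (g + h) n * entire_coeff f n) sums
        dual_apply (germ_functional g + germ_functional h) f"
      using sums_add[OF sums_germ_functional[of g f] sums_germ_functional[of h f]]
      by (simp add: germ_coeff_add distrib_right)
  qed
qed

lemma germ_functional_scale: "germ_functional (germ_scale c g) = dual_scale c (germ_functional g)"
proof (rule entire_dual_eqI)
  fix f
  show "dual_apply (germ_functional (germ_scale c g)) f = dual_apply (dual_scale c (germ_functional g)) f"
    using sums_germ_functional[of "germ_scale c g" f]
  proof (rule sums_unique2)
    show "(\<lambda>n. germ_coeff (germ_scale c g) n * entire_coeff f n) sums
        dual_apply (dual_scale c (germ_functional g)) f"
      using sums_mult[OF sums_germ_functional[of g f], of c]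
      by (simp add: germ_coeff_scale mult.assoc)
  qed
qed

lemma germ_functional_diff: "germ_functional (g - h) = germ_functional g - germ_functional h"
  by (metis germ_functional_add diff_add_cancel eq_diff_eq)

lemma dual_apply_germ_functional_power:
  "dual_apply (germ_functional g) (entire_power k) = germ_coeff g k"
proof -
  have "(\<lambda>n. germ_coeff g n * entire_coeff (entire_power k) n) = (\<lambda>n. if n = k then germ_coeff g n else 0)"
    by (auto simp: entire_coeff_power)
  then show ?thesis
    using sums_germ_functional[of g "entire_power k"] sums_single[of k "germ_coeff g"]
    by (simp add: sums_iff)
qed

lemma inj_germ_functional: "inj germ_functional"
  by (rule injI, rule germ_eqI) (metis dual_apply_germ_functional_power)

text \<open>For surjectivity, the monomial of degree \<open>n\<close> is at most
  \<open>R ^ n\<close> on the controlling disc, so the values of \<open>\<phi>\<close> on monomials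
  are coefficients of a germ. Its functional agrees with \<open>\<phi>\<close> by termwise
  evaluation.\<close>

lemma bij_germ_functional: "bij germ_functional"
proof -
  have "\<exists>g. germ_functional g = \<phi>" for \<phi>
  proof -
    obtain R C where R: "R > 0" "C > 0"
      and bound: "\<And>f M. M > 0 \<Longrightarrow> (\<And>z. z \<in> cball 0 R \<Longrightarrow> cmod (entire_apply f z) \<le> M) \<Longrightarrow>
         cmod (dual_apply \<phi> f) \<le> C * M"
      by (rule dual_apply_bound) blast
    have "cmod (dual_apply \<phi> (entire_power n)) \<le> C * R ^ n" for n
    proof (rule bound)
      show "cmod (entire_apply (entire_power n) z) \<le> R ^ n" if "z \<in> cball 0 R" for z
        using that by (simp add: entire_power.rep_eq norm_power power_mono)
    qed (use R(1) in simp)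
    then obtain g where g: "\<And>n. germ_coeff g n = dual_apply \<phi> (entire_power n)"
      by (rule germ_of_coeffs[OF R(1)]) blast
    have "germ_functional g = \<phi>"
    proof (rule entire_dual_eqI)
      fix f
      show "dual_apply (germ_functional g) f = dual_apply \<phi> f"
        using sums_germ_functional[of g f]
      proof (rule sums_unique2)
        show "(\<lambda>n. germ_coeff g n * entire_coeff f n) sums dual_apply \<phi> f"
          using dual_apply_sums[of f \<phi>] by (simp add: g mult.commute)
      qed
    qed
    then show ?thesis ..
  qed
  then have "surj germ_functional"
    by (intro surjI[of _ "\<lambda>\<phi>. SOME g. germ_functional g = \<phi>"]) (rule someI_ex)
  with inj_germ_functional show ?thesis by (rule bijI)
qed

section \<open>Comparison of the topologies\<close>

text \<open>With \<open>r = 1 / 2 ^ p\<close>, the pairing involves elements of \<open>B\<close>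
  only on the disc of radius \<open>2 / r\<close>, where they share a bound \<open>N\<close>; the
  constant is \<open>2 * N\<close>.\<close>

lemma germ_functional_bounded_on_hardy2:
  assumes B: "tvs_bounded entire_scale entire_topology B" "B \<noteq> {}"
  shows "\<exists>C. \<forall>f\<in>hardy2 (- int p).
    (SUP h\<in>B. cmod (dual_apply (germ_functional (germ_of f)) h)) \<le> C * hardy2_norm (- int p) f"
proof -
  let ?r = "1 / 2 ^ p :: real"
  obtain N where N: "N > 0" "\<And>h z. h \<in> B \<Longrightarrow> z \<in> cball 0 (2 / ?r) \<Longrightarrow> cmod (entire_apply h z) \<le> N"
    by (rule tvs_bounded_entireD[OF B(1), of "2 / ?r"]) (simp, blast)
  have "(SUP h\<in>B. cmod (dual_apply (germ_functional (germ_of f)) h)) \<le> 2 * hardy2_norm (- int p) f * N"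
    if f: "f \<in> hardy2 (- int p)" for f
    using B(2)
  proof (rule cSUP_least)
    fix h assume "h \<in> B"
    then show "cmod (dual_apply (germ_functional (germ_of f)) h) \<le> 2 * hardy2_norm (- int p) f * N"
      unfolding dual_apply_germ_functional
      by (intro coeff_pairing[of ?r] germ_coeff_le_hardy2_norm f N) auto
  qed
  then show ?thesis by (intro exI[of _ "2 * N"]) (auto simp: mult_ac)
qed

text \<open>One bounded set, built from \<open>q\<close> alone, must serve all germs; only the
  member at which the bound is reached depends on \<open>g\<close>. This gives continuity of the
  inverse map.\<close>

lemma germ_seminorm_le_strong:
  assumes q: "seminorm germ_scale q"
    and dom: "\<And>p. \<exists>C. \<forall>f\<in>hardy2 (- int p). q (germ_of f) \<le> C * hardy2_norm (- int p) f"
  shows "\<exists>B. tvs_bounded entire_scale entire_topology B \<and> B \<noteq> {} \<and>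
    (\<forall>g. q g \<le> (SUP f\<in>B. cmod (dual_apply (germ_functional g) f)))"
proof -
  define a where "a n = q (germ_power n)" for n
  have a0: "0 \<le> a n" for n
    unfolding a_def by (rule seminorm_nonneg[OF vector_space_germ q])
  have summable_a: "summable (\<lambda>n. a n * R ^ n)" if R: "R > 0" for R
  proof -
    \<comment> \<open>This makes the ratio \<open>R / 2 ^ p\<close> smaller than
      \<open>1 / 2\<close>.\<close>
    obtain p where p: "2 * R < 2 ^ p" using real_arch_pow[of 2 "2 * R"] by auto
    obtain C where C: "\<forall>f\<in>hardy2 (- int p). q (germ_of f) \<le> C * hardy2_norm (- int p) f"
      using dom by blast
    show ?thesis
    proof (rule summable_comparison_test')
      show "summable (\<lambda>n. C * (1 / 2) ^ n)"
        by (intro summable_mult summable_geometric) simp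
      fix n
      have le: "a n \<le> C * (1 / 2 ^ p) ^ n"
        using bspec[OF C hardy2_power(1)[of n p]] unfolding a_def hardy2_power(2) .
      then have "0 \<le> C * (1 / 2 ^ p) ^ n" using a0[of n] by linarith
      moreover have "(1 / 2 ^ p) ^ n > (0::real)" by simp
      \<comment> \<open>The sign of \<open>C\<close> is not assumed but follows from
        \<open>0 \<le> a n\<close>; enlarging the ratio to \<open>1 / 2\<close> below relies on
        it.\<close>
      ultimately have "C \<ge> 0" by (metis mult_neg_pos not_le)
      have "a n * R ^ n \<le> C * (1 / 2 ^ p) ^ n * R ^ n"
        using le R by (intro mult_right_mono) auto
      also have "\<dots> = C * (R / 2 ^ p) ^ n"
        by (simp add: power_divide)
      also have "\<dots> \<le> C * (1 / 2) ^ n"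
        using \<open>C \<ge> 0\<close> p R by (intro mult_left_mono power_mono) (auto simp: field_simps)
      finally show "norm (a n * R ^ n) \<le> C * (1 / 2) ^ n"
        using a0[of n] R by simp
    qed
  qed
  let ?B = "{f. \<forall>n. cmod (entire_coeff f n) \<le> a n}"
  have B: "tvs_bounded entire_scale entire_topology ?B"
    using summable_a by (rule tvs_bounded_coeffs_le)
  have ex: "\<exists>f\<in>?B. q g \<le> cmod (dual_apply (germ_functional g) f)" for g
  proof -
    \<comment> \<open>The conjugate phase turns each term of the pairing into the nonnegative real
      \<open>cmod (germ_coeff g n) * a n\<close>; since \<open>sgn 0 = 0\<close>, this includes
      vanishing coefficients.\<close>
    let ?c = "\<lambda>n. of_real (a n) * cnj (sgn (germ_coeff g n))"
    have c: "cmod (?c n) \<le> a n" for n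
      using a0[of n] by (simp add: norm_mult norm_sgn)
    have "summable (\<lambda>n. cmod (?c n) * R ^ n)" if "R > 0" for R
      using summable_a[OF that]
    proof (rule summable_comparison_test'[where N = 0])
      show "norm (cmod (?c n) * R ^ n) \<le> a n * R ^ n" for n
        using c[of n] that by (auto simp: abs_mult intro!: mult_right_mono)
    qed
    then obtain f where f: "\<And>n. entire_coeff f n = ?c n"
      using entire_of_coeffs[of ?c] by blast
    have prod: "germ_coeff g n * entire_coeff f n = of_real (cmod (germ_coeff g n) * a n)" for n
    proof (cases "germ_coeff g n = 0")
      case False
      then have "germ_coeff g n * cnj (sgn (germ_coeff g n)) = of_real (cmod (germ_coeff g n))"
        using complex_norm_square[of "germ_coeff g n"]
        by (simp add: sgn_eq power2_eq_square divide_eq_eq)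
      then show ?thesis
        unfolding f of_real_mult by (metis mult.assoc mult.commute)
    qed simp
    have nn: "0 \<le> cmod (germ_coeff g n) * a n" for n using a0 by simp
    have sm: "summable (\<lambda>n. cmod (germ_coeff g n) * a n)"
      using summable_germ_pairing[of g f] nn by (simp only: prod norm_of_real abs_of_nonneg)
    have "dual_apply (germ_functional g) f = of_real (\<Sum>n. cmod (germ_coeff g n) * a n)"
      unfolding dual_apply_germ_functional prod using sm by (rule suminf_of_real[symmetric])
    then have val: "cmod (dual_apply (germ_functional g) f) = (\<Sum>n. cmod (germ_coeff g n) * a n)"
      using suminf_nonneg[OF sm nn] by simp
    obtain u where u: "u analytic_on {0}" "g = germ_of u" by (rule germ_cases)
    obtain p where p: "u \<in> hardy2 (- int p)" using u(1) by (rule analytic_imp_hardy2)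
    obtain C where C: "\<forall>f\<in>hardy2 (- int p). q (germ_of f) \<le> C * hardy2_norm (- int p) f"
      using dom by blast
    define F where "F N z = u z - (\<Sum>n<N. germ_coeff (germ_of u) n * z ^ n)" for N z
    note F = hardy2_remainder[OF p, folded F_def]
    \<comment> \<open>Subadditivity handles only finite sums. The remainder is measured in a Hardy
      norm that tends to 0, and the limit gives the bound by the full series.\<close>
    have "q g \<le> (\<Sum>n. cmod (germ_coeff g n) * a n) + C * hardy2_norm (- int p) (F N)" for N
    proof -
      let ?P = "\<Sum>n<N. germ_scale (germ_coeff g n) (germ_power n)"
      have "q g \<le> q ?P + q (g - ?P)"
        using seminorm_add[OF q, of ?P "g - ?P"] by simp
      also have "q (g - ?P) \<le> C * hardy2_norm (- int p) (F N)"
        using C F(1)[of N] unfolding u(2) F(2)[of N, symmetric] by blast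
      also have "q ?P \<le> (\<Sum>n<N. cmod (germ_coeff g n) * a n)"
        using seminorm_sum[OF vector_space_germ q, of "\<lambda>n. germ_scale (germ_coeff g n) (germ_power n)" "{..<N}"]
        by (simp add: seminorm_scale[OF q] a_def)
      also have "\<dots> \<le> (\<Sum>n. cmod (germ_coeff g n) * a n)"
        using sm nn by (intro sum_le_suminf) auto
      finally show ?thesis by simp
    qed
    moreover have "(\<lambda>N. (\<Sum>n. cmod (germ_coeff g n) * a n) + C * hardy2_norm (- int p) (F N))
        \<longlonglongrightarrow> (\<Sum>n. cmod (germ_coeff g n) * a n) + C * 0"
      by (intro tendsto_add tendsto_mult tendsto_const F(3))
    ultimately have "q g \<le> (\<Sum>n. cmod (germ_coeff g n) * a n) + C * 0"
      by (intro LIMSEQ_le_const) auto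
    then show ?thesis
      using f c val by (intro bexI[of _ f]) auto
  qed
  have "q g \<le> (SUP f\<in>?B. cmod (dual_apply (germ_functional g) f))" for g
  proof -
    obtain f where "f \<in> ?B" "q g \<le> cmod (dual_apply (germ_functional g) f)"
      using ex by blast
    then show ?thesis
      by (intro cSUP_upper2[OF bdd_above_dual_apply[OF B]])
  qed
  moreover have "?B \<noteq> {}" using ex by blast
  ultimately show ?thesis using B by blast
qed

text \<open>The pairing formula determines \<open>\<Phi>\<close> uniquely, so the identification is
  a specific map rather than an abstract isomorphism.\<close>

theorem proposition4p2:
  shows "\<exists>\<Phi> :: germ0 \<Rightarrow> entire_dual.
           Vector_Spaces.linear germ_scale dual_scale \<Phi> \<and>
           homeomorphic_map germ_topology strong_dual_topology \<Phi> \<and>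
           (\<forall>g f. (\<lambda>n. germ_coeff g n * entire_coeff f n) sums dual_apply (\<Phi> g) f)"
proof (intro exI[of _ germ_functional] conjI allI)
  show "Vector_Spaces.linear germ_scale dual_scale germ_functional"
    by (simp add: Vector_Spaces.linear_iff vector_space_germ vector_space_dual
        germ_functional_add germ_functional_scale)
  show "(\<lambda>n. germ_coeff g n * entire_coeff f n) sums dual_apply (germ_functional g) f" for g f
    by (rule sums_germ_functional)
  let ?P = "{q. seminorm germ_scale q \<and>
      (\<forall>p::nat. \<exists>C. \<forall>f\<in>hardy2 (- int p). q (germ_of f) \<le> C * hardy2_norm (- int p) f)}"
  let ?Q = "{\<lambda>\<phi>. SUP f\<in>B. cmod (dual_apply \<phi> f) | B.
      tvs_bounded entire_scale entire_topology B \<and> B \<noteq> {}}"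
  let ?\<Psi> = "inv germ_functional"
  have inv: "?\<Psi> (germ_functional g) = g" "germ_functional (?\<Psi> \<phi>) = \<phi>" for g \<phi>
    using bij_germ_functional by (simp_all add: bij_is_inj bij_is_surj surj_f_inv_f)
  have P: "\<And>p. p \<in> ?P \<Longrightarrow> seminorm germ_scale p" by blast
  \<comment> \<open>The zero seminorm and the bounded set \<open>{0}\<close> make both families
    nonempty, so that the semiballs cover each space.\<close>
  have "(\<lambda>_. 0) \<in> ?P" by (auto simp: seminorm_def intro!: exI[of _ 0])
  then have Pne: "?P \<noteq> {}" by blast
  have "tvs_bounded entire_scale entire_topology {0}"
    by (rule tvs_bounded_entireI) (auto intro!: exI[of _ 0])
  then have Qne: "?Q \<noteq> {}" by blast
  have "continuous_map germ_topology strong_dual_topology germ_functional"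
    unfolding germ_topology_def strong_dual_topology_def
  proof (rule continuous_map_seminorm_topology[OF vector_space_germ P Pne
        vector_space_dual seminorm_strong_dual Qne germ_functional_diff])
    fix q assume q: "q \<in> ?Q"
    \<comment> \<open>The pullback of a strong seminorm is itself one of the seminorms defining the
      germ topology, so the required domination is an equality.\<close>
    have "seminorm germ_scale (\<lambda>g. q (germ_functional g))"
      using seminorm_strong_dual[OF q]
      by (simp add: seminorm_def germ_functional_add germ_functional_scale)
    then have "(\<lambda>g. q (germ_functional g)) \<in> ?P"
      using q germ_functional_bounded_on_hardy2 by auto
    then show "\<exists>p\<in>?P. \<forall>g. q (germ_functional g) \<le> p g"
      by (rule bexI[rotated]) simp
  qed
  moreover have "continuous_map strong_dual_topology germ_topology ?\<Psi>"
    unfolding germ_topology_def strong_dual_topology_def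
  proof (rule continuous_map_seminorm_topology[OF vector_space_dual seminorm_strong_dual Qne
        vector_space_germ P Pne])
    show "?\<Psi> (\<phi> - \<psi>) = ?\<Psi> \<phi> - ?\<Psi> \<psi>" for \<phi> \<psi>
      by (metis germ_functional_diff inv)
    fix q assume "q \<in> ?P"
    then obtain B where B: "tvs_bounded entire_scale entire_topology B" "B \<noteq> {}"
      and le: "\<And>g. q g \<le> (SUP f\<in>B. cmod (dual_apply (germ_functional g) f))"
      using germ_seminorm_le_strong[of q] by blast
    have "q (?\<Psi> \<phi>) \<le> (SUP f\<in>B. cmod (dual_apply \<phi> f))" for \<phi>
      using le[of "?\<Psi> \<phi>"] by (simp add: inv)
    then show "\<exists>p\<in>?Q. \<forall>\<phi>. q (?\<Psi> \<phi>) \<le> p \<phi>"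
      using B by (intro bexI[of _ "\<lambda>\<phi>. SUP f\<in>B. cmod (dual_apply \<phi> f)"]) auto
  qed
  ultimately show "homeomorphic_map germ_topology strong_dual_topology germ_functional"
    by (intro homeomorphic_maps_imp_map[of _ _ _ ?\<Psi>]) (simp add: homeomorphic_maps_def inv)
qed

end
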